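(* Let $n,k$ be positive integers with $2\leq 2k<n$ and $\gcd(n,k)=d\geq 2$. Then $D(P_{n,k})\leq d\lfloor n/(2d)\rfloor+d+1$.
   Context: For positive integers $n,k$ with $2\le 2k<n$, the generalised Petersen graph $P_{n,k}$ has vertex set $\{u_i,v_i: i\in\{0,\dots,n-1\}\}$ and edge set $\{u_iu_{i+1}, v_iv_{i+k}, u_iv_i : i\in\{0,\dots,n-1\}\}$, indices modulo $n$. A signed graph $(G,E_-)$ is a simple graph $G$ with a set $E_-\subseteq E(G)$ of negative edges; other edges are positive. A cycle is positive if the product of its edge signs is positive; a signed graph is balanced if every cycle is positive. The frustration index $l(G,E_-)$ is the minimum number of edges whose deletion leaves a balanced signed graph, and the maximum frustration is $D(G)=\max_{E_-\subseteq E(G)} l(G,E_-)$. *)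

theory Defs
  imports Main
begin

record 'a ugraph =
  verts :: "'a set"
  edges :: "'a set set"

definition simple_graph :: "'a ugraph \<Rightarrow> bool" where
  "simple_graph G \<longleftrightarrow> (\<forall>e\<in>edges G. e \<subseteq> verts G \<and> card e = 2)"

definition delete_edges :: "'a ugraph \<Rightarrow> 'a set set \<Rightarrow> 'a ugraph" where
  "delete_edges G F = \<lparr>verts = verts G, edges = edges G - F\<rparr>"

text \<open>A cycle is given by the list of its vertices in cyclic order, each listed once;
  the last vertex is adjacent to the first one.\<close>

definition cycle_edge :: "'a list \<Rightarrow> nat \<Rightarrow> 'a set" where
  "cycle_edge c i = {c ! i, c ! ((i + 1) mod length c)}"

definition is_cycle :: "'a ugraph \<Rightarrow> 'a list \<Rightarrow> bool" where
  "is_cycle G c \<longleftrightarrow> 3 \<le> length c \<and> distinct c \<and> set c \<subseteq> verts G \<and>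
     (\<forall>i<length c. cycle_edge c i \<in> edges G)"

text \<open>A signed graph is passed as two arguments: a simple graph \<open>G\<close> and its set
  \<open>N \<subseteq> edges G\<close> of negative edges.\<close>

definition edge_sign :: "'a set set \<Rightarrow> 'a set \<Rightarrow> int" where
  "edge_sign N e = (if e \<in> N then - 1 else 1)"

definition positive_cycle :: "'a set set \<Rightarrow> 'a list \<Rightarrow> bool" where
  "positive_cycle N c \<longleftrightarrow> (\<Prod>i<length c. edge_sign N (cycle_edge c i)) > 0"

definition balanced :: "'a ugraph \<Rightarrow> 'a set set \<Rightarrow> bool" where
  "balanced G N \<longleftrightarrow> (\<forall>c. is_cycle G c \<longrightarrow> positive_cycle N c)"

text \<open>The next two definitions are meant for graphs with finitely many edges; there the
  minimum and the maximum range over finite nonempty sets (see the lemmas below).\<close>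

definition frustration_index :: "'a ugraph \<Rightarrow> 'a set set \<Rightarrow> nat" where
  "frustration_index G N =
     Min {card F | F. F \<subseteq> edges G \<and> balanced (delete_edges G F) (N - F)}"

definition max_frustration :: "'a ugraph \<Rightarrow> nat" where
  "max_frustration G = Max {frustration_index G N | N. N \<subseteq> edges G}"

datatype pvertex = U nat | V nat

definition gen_petersen :: "nat \<Rightarrow> nat \<Rightarrow> pvertex ugraph" where
  "gen_petersen n k =
     \<lparr>verts = {U i | i. i < n} \<union> {V i | i. i < n},
      edges = {{U i, U ((i + 1) mod n)} | i. i < n}
            \<union> {{V i, V ((i + k) mod n)} | i. i < n}
            \<union> {{U i, V i} | i. i < n}\<rparr>"

lemma frustration_index_set_finite_nonempty:
  assumes "finite (edges G)"
  shows "finite {card F | F. F \<subseteq> edges G \<and> balanced (delete_edges G F) (N - F)}"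
    and "{card F | F. F \<subseteq> edges G \<and> balanced (delete_edges G F) (N - F)} \<noteq> {}"
proof -
  show "finite {card F | F. F \<subseteq> edges G \<and> balanced (delete_edges G F) (N - F)}"
    by (rule finite_subset[of _ "card ` Pow (edges G)"]) (use assms in auto)
  have "\<not> is_cycle (delete_edges G (edges G)) c" for c
  proof
    assume "is_cycle (delete_edges G (edges G)) c"
    then have "3 \<le> length c" "\<forall>i<length c. False"
      by (simp_all add: is_cycle_def delete_edges_def)
    then show False by (cases c) auto
  qed
  then have "balanced (delete_edges G (edges G)) (N - edges G)"
    by (simp add: balanced_def)
  then show "{card F | F. F \<subseteq> edges G \<and> balanced (delete_edges G F) (N - F)} \<noteq> {}"
    by blast
qed

lemma max_frustration_set_finite_nonempty:
  assumes "finite (edges G)"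
  shows "finite {frustration_index G N | N. N \<subseteq> edges G}"
    and "{frustration_index G N | N. N \<subseteq> edges G} \<noteq> {}"
proof -
  have "{frustration_index G N | N. N \<subseteq> edges G} = frustration_index G ` Pow (edges G)"
    by auto
  with assms show "finite {frustration_index G N | N. N \<subseteq> edges G}" by simp
qed blast

lemma finite_edges_gen_petersen: "finite (edges (gen_petersen n k))"
  by (simp add: gen_petersen_def)

lemma simple_graph_gen_petersen:
  assumes "2 \<le> 2 * k" and "2 * k < n"
  shows "simple_graph (gen_petersen n k)"
proof -
  have ne: "i \<noteq> (i + j) mod n" if "i < n" "0 < j" "j < n" for i j
  proof (cases "i + j < n")
    case False
    then have "(i + j) mod n = i + j - n" using that by (simp add: mod_if)
    with that False show ?thesis by linarith
  qed (use that in auto)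
  have "card {U i, U ((i + 1) mod n)} = 2" if "i < n" for i
    using ne[of i 1] that assms by simp
  moreover have "card {V i, V ((i + k) mod n)} = 2" if "i < n" for i
    using ne[of i k] that assms by simp
  ultimately show ?thesis
    using assms by (auto simp: simple_graph_def gen_petersen_def)
qed

end

theory Submission
  imports Defs "HOL-Number_Theory.Cong"
begin

text \<open>
  For every vertex labelling \<open>s\<close> by \<open>1\<close> and \<open>- 1\<close>, deleting the edges whose sign is not the product
  of the labels of their ends leaves a balanced graph. The inner edges form \<open>d\<close> cycles of length
  \<open>n / d\<close>. Label the outer cycle and every inner cycle so that all of its edges but one agree with
  the labelling. Negating the labelling of a whole inner cycle does not affect its edges, but
  exchanges agreeing and disagreeing spokes, so at most half of its \<open>n / d\<close> spokes need to
  disagree. This leaves at most \<open>1\<close> outer edge, \<open>d\<close> inner edges and \<open>d * (n div (2 * d))\<close> spokes.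
\<close>

text \<open>The product runs over the set \<open>e\<close>, so it is the product of two end labels
  only once the ends are known to differ.\<close>

definition frustrated_edges :: "'a ugraph \<Rightarrow> 'a set set \<Rightarrow> ('a \<Rightarrow> int) \<Rightarrow> 'a set set" where
  "frustrated_edges G N s = {e \<in> edges G. edge_sign N e \<noteq> (\<Prod>v\<in>e. s v)}"

lemma edge_sign_cases: "edge_sign N e \<in> {1, -1}"
  by (simp add: edge_sign_def)

lemma prod_in_signs:
  fixes f :: "'a \<Rightarrow> int"
  assumes "\<And>x. x \<in> A \<Longrightarrow> f x \<in> {1, -1}"
  shows "prod f A \<in> {1, -1}"
  using assms by (induction A rule: infinite_finite_induct) fastforce+

lemma prod_cyclic_shift:
  fixes f :: "nat \<Rightarrow> 'a::comm_monoid_mult"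
  shows "(\<Prod>i<l. f ((i + 1) mod l)) = (\<Prod>i<l. f i)"
proof (cases l)
  case (Suc m)
  have "(\<Prod>i<Suc m. f ((i + 1) mod Suc m)) = (\<Prod>i<m. f (Suc i)) * f 0"
    by simp
  also have "\<dots> = (\<Prod>i<Suc m. f i)"
    by (simp add: prod.lessThan_Suc_shift mult.commute del: prod.lessThan_Suc)
  finally show ?thesis using Suc by simp
qed simp

text \<open>Every surviving edge has as its sign the product of its end labels. Around a cycle each
  label enters twice, by \<open>prod_cyclic_shift\<close>, so the signs multiply to a square of a
  sign.\<close>

lemma balanced_delete_frustrated_edges:
  assumes s: "\<And>v. s v \<in> {1, -1}"
  shows "balanced (delete_edges G (frustrated_edges G N s)) (N - frustrated_edges G N s)"
  unfolding balanced_def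
proof (intro allI impI)
  define F where "F = frustrated_edges G N s"
  fix c assume "is_cycle (delete_edges G (frustrated_edges G N s)) c"
  then have c: "is_cycle (delete_edges G F) c"
    by (simp add: F_def)
  let ?l = "length c"
  have edge: "edge_sign (N - F) (cycle_edge c i) = s (c ! i) * s (c ! ((i + 1) mod ?l))"
    if "i < ?l" for i
  proof -
    have "cycle_edge c i \<in> edges G - F"
      using c that by (simp add: is_cycle_def delete_edges_def)
    then have "edge_sign (N - F) (cycle_edge c i) = (\<Prod>v\<in>cycle_edge c i. s v)"
      by (auto simp: F_def frustrated_edges_def edge_sign_def)
    moreover have "c ! i \<noteq> c ! ((i + 1) mod ?l)"
      using c that by (auto simp: is_cycle_def nth_eq_iff_index_eq mod_if)
    ultimately show ?thesis by (simp add: cycle_edge_def)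
  qed
  have "(\<Prod>i<?l. edge_sign (N - F) (cycle_edge c i))
      = (\<Prod>i<?l. s (c ! i)) * (\<Prod>i<?l. s (c ! ((i + 1) mod ?l)))"
    by (simp add: edge prod.distrib)
  also have "\<dots> = (\<Prod>i<?l. s (c ! i)) * (\<Prod>i<?l. s (c ! i))"
    by (simp only: prod_cyclic_shift[of "\<lambda>i. s (c ! i)"])
  also have "\<dots> = 1"
    using prod_in_signs[of "{..<?l}" "\<lambda>i. s (c ! i)"] s by force
  finally show "positive_cycle (N - frustrated_edges G N s) c"
    by (simp add: positive_cycle_def F_def)
qed

lemma frustration_index_le_card_frustrated_edges:
  assumes "finite (edges G)" and "\<And>v. s v \<in> {1, -1}"
  shows "frustration_index G N \<le> card (frustrated_edges G N s)"
  unfolding frustration_index_def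
proof (rule Min_le[OF frustration_index_set_finite_nonempty(1)[OF assms(1)]])
  have "frustrated_edges G N s \<subseteq> edges G"
    by (auto simp: frustrated_edges_def)
  with balanced_delete_frustrated_edges[of s G N] assms(2)
  show "card (frustrated_edges G N s)
      \<in> {card F | F. F \<subseteq> edges G \<and> balanced (delete_edges G F) (N - F)}"
    by blast
qed

lemma max_frustration_leI:
  assumes "finite (edges G)" and "\<And>N. N \<subseteq> edges G \<Longrightarrow> frustration_index G N \<le> b"
  shows "max_frustration G \<le> b"
  unfolding max_frustration_def
  using max_frustration_set_finite_nonempty[OF assms(1)] assms(2) by auto

text \<open>Each \<open>g x\<close> differs from exactly one of \<open>f x\<close> and
  \<open>- f x\<close>, so the two disagreement sets partition \<open>A\<close> and the smaller has
  at most half of it.\<close>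

lemma ex_sign_few_disagreements:
  fixes f g :: "'a \<Rightarrow> int"
  assumes "finite A" and "\<And>x. x \<in> A \<Longrightarrow> f x \<in> {1, -1}" "\<And>x. x \<in> A \<Longrightarrow> g x \<in> {1, -1}"
  shows "\<exists>e\<in>{1, -1}. card {x \<in> A. g x \<noteq> e * f x} \<le> card A div 2"
proof -
  let ?D = "\<lambda>e. {x \<in> A. g x \<noteq> e * f x}"
  have "?D 1 \<union> ?D (-1) = A" "?D 1 \<inter> ?D (-1) = {}"
    using assms(2,3) by force+
  then have "card A = card (?D 1) + card (?D (-1))"
    using card_Un_disjoint[of "?D 1" "?D (-1)"] \<open>finite A\<close> by simp
  then have "card (?D 1) \<le> card A div 2 \<or> card (?D (-1)) \<le> card A div 2"
    by linarith
  then show ?thesis by blast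
qed

text \<open>Modulo \<open>n\<close>, the multiples of \<open>k\<close> form a subgroup of order
  \<open>n div d\<close>, with coset representatives the residues below \<open>d\<close>. Thus
  \<open>r\<close> selects an inner cycle and \<open>p\<close> a position along it.\<close>

lemma bij_betw_residue_cosets:
  fixes n k d :: nat
  assumes "0 < n" and d: "gcd n k = d"
  shows "bij_betw (\<lambda>(r, p). (r + p * k) mod n) ({..<d} \<times> {..<n div d}) {..<n}"
proof -
  let ?f = "\<lambda>(r, p). (r + p * k) mod n" and ?A = "{..<d} \<times> {..<n div d}"
  have "0 < d" "d dvd n" "d dvd k" using assms by auto
  then have n: "n = d * (n div d)" and k: "k = d * (k div d)" by auto
  have cop: "coprime (k div d) (n div d)"
    using div_gcd_coprime[of n k] assms by (simp add: coprime_commute)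
  have inj: "inj_on ?f ?A"
  proof (rule inj_onI, clarsimp)
    fix r p r' p'
    assume *: "r < d" "r' < d" "p < n div d" "p' < n div d"
      and eq: "(r + p * k) mod n = (r' + p' * k) mod n"
    from eq have "(r + p * k) mod d = (r' + p' * k) mod d"
      using \<open>d dvd n\<close> by (metis mod_mod_cancel)
    moreover have "(a + b * k) mod d = a mod d" for a b
      using \<open>d dvd k\<close> by (metis dvd_mult mod_add_right_eq dvd_imp_mod_0 add.right_neutral)
    ultimately have r: "r = r'" using * by simp
    with eq have "[p * k = p' * k] (mod n)"
      by (simp add: cong_def[symmetric] cong_add_lcancel_nat)
    \<comment> \<open>Exposing the factor \<open>d\<close> on both sides and in the modulus lets it
      cancel; then \<open>k div d\<close> is invertible modulo \<open>n div d\<close>.\<close>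
    then have "[d * (p * (k div d)) = d * (p' * (k div d))] (mod d * (n div d))"
      using n k by (metis mult.left_commute)
    then have "[p * (k div d) = p' * (k div d)] (mod n div d)"
      using \<open>0 < d\<close> by (simp add: cong_def mult_mod_right[symmetric])
    then have "[p = p'] (mod n div d)"
      using cop by (simp add: cong_mult_rcancel_nat)
    with * have "p = p'" by (simp add: cong_def)
    with r show "r = r' \<and> p = p'" by simp
  qed
  have "?f ` ?A \<subseteq> {..<n}" using \<open>0 < n\<close> by auto
  \<comment> \<open>Surjectivity follows by counting, since
    \<open>d * (n div d) = n\<close>.\<close>
  moreover have "card (?f ` ?A) = card {..<n}"
    using card_image[OF inj] n by simp
  ultimately have "?f ` ?A = {..<n}" by (simp add: card_subset_eq)
  with inj show ?thesis by (simp add: bij_betw_def)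
qed

lemma frustration_index_gen_petersen_le:
  fixes n k d :: nat
  assumes k: "2 \<le> 2 * k" "2 * k < n" and d: "gcd n k = d"
  shows "frustration_index (gen_petersen n k) N \<le> d * (n div (2 * d)) + d + 1"
proof -
  define m where "m = n div d"
  define \<phi> where "\<phi> = (\<lambda>(r, p). (r + p * k) mod n)"
  have "0 < n" using k by simp
  then have "0 < d" "n = d * m" using d unfolding m_def by auto
  have bij: "bij_betw \<phi> ({..<d} \<times> {..<m}) {..<n}"
    using bij_betw_residue_cosets[OF \<open>0 < n\<close> d] by (simp add: \<phi>_def m_def)
  define out where "out i = {U i, U ((i + 1) mod n)}" for i
  define inn where "inn i = {V i, V ((i + k) mod n)}" for i
  define spoke where "spoke i = {U i, V i}" for i
  have \<phi>_Suc: "\<phi> (r, Suc p) = (\<phi> (r, p) + k) mod n" for r p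
    by (simp add: \<phi>_def mod_add_right_eq ac_simps)
  have ne: "U i \<noteq> U ((i + 1) mod n)" "V i \<noteq> V ((i + k) mod n)" if "i < n" for i
  proof -
    have "card (out i) = 2" "card (inn i) = 2"
      using simple_graph_gen_petersen[OF k] that
      by (auto simp: simple_graph_def gen_petersen_def out_def inn_def)
    then show "U i \<noteq> U ((i + 1) mod n)" "V i \<noteq> V ((i + k) mod n)"
      by (auto simp: out_def inn_def)
  qed

  \<comment> \<open>Partial products of signs: consecutive labels differ by the sign of the edge
    between them, so only the edge closing each cycle can be frustrated.\<close>
  define a where "a i = (\<Prod>j<i. edge_sign N (out j))" for i
  define b where "b r p = (\<Prod>j<p. edge_sign N (inn (\<phi> (r, j))))" for r p
  have a: "a i \<in> {1, -1}" for i
    unfolding a_def by (rule prod_in_signs) (rule edge_sign_cases)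
  have b: "b r p \<in> {1, -1}" for r p
    unfolding b_def by (rule prod_in_signs) (rule edge_sign_cases)

  \<comment> \<open>The positions on inner cycle \<open>r\<close> whose spokes are frustrated when
    that cycle carries the labels \<open>\<epsilon> * b r p\<close>.\<close>
  define D where "D r \<epsilon> = {p \<in> {..<m}. a (\<phi> (r, p)) * edge_sign N (spoke (\<phi> (r, p))) \<noteq> \<epsilon> * b r p}"
    for r \<epsilon>
  have "\<exists>\<epsilon>\<in>{1, -1}. card (D r \<epsilon>) \<le> m div 2" for r
  proof -
    have "a (\<phi> (r, p)) * edge_sign N (spoke (\<phi> (r, p))) \<in> {1, -1}" for p
      using a[of "\<phi> (r, p)"] edge_sign_cases[of N "spoke (\<phi> (r, p))"] by auto
    then show ?thesis
      using ex_sign_few_disagreements[of "{..<m}" "b r"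
          "\<lambda>p. a (\<phi> (r, p)) * edge_sign N (spoke (\<phi> (r, p)))"] b
      by (simp add: D_def)
  qed
  then obtain \<epsilon> where \<epsilon>: "\<And>r. \<epsilon> r \<in> {1, -1}" "\<And>r. card (D r (\<epsilon> r)) \<le> m div 2"
    by metis

  \<comment> \<open>Outside \<open>{..<n}\<close> the value of \<open>\<psi>\<close> is arbitrary,
    but \<open>s\<close> still yields signs because \<open>\<epsilon>\<close> and \<open>b\<close>
    do so for all arguments.\<close>
  define \<psi> where "\<psi> = inv_into ({..<d} \<times> {..<m}) \<phi>"
  define s where "s v = (case v of U i \<Rightarrow> a i | V i \<Rightarrow> (case \<psi> i of (r, p) \<Rightarrow> \<epsilon> r * b r p))" for v
  have sU: "s (U i) = a i" for i by (simp add: s_def)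
  have sV: "s (V (\<phi> (r, p))) = \<epsilon> r * b r p" if "r < d" "p < m" for r p
    using bij_betw_inv_into_left[OF bij, of "(r, p)"] that by (simp add: s_def \<psi>_def)
  have s: "s v \<in> {1, -1}" for v
  proof (cases v)
    case (V i)
    obtain r p where "\<psi> i = (r, p)" by force
    then show ?thesis using V \<epsilon>(1)[of r] b[of r p] by (auto simp: s_def)
  qed (use a in \<open>simp add: s_def\<close>)

  define F where "F = frustrated_edges (gen_petersen n k) N s"
  \<comment> \<open>The closing edges start at \<open>n - 1\<close> on the outer cycle and at
    position \<open>m - 1\<close> on each inner one.\<close>
  define B where "B = insert (out (n - 1)) ((\<lambda>r. inn (\<phi> (r, m - 1))) ` {..<d}
      \<union> (\<Union>r<d. (\<lambda>p. spoke (\<phi> (r, p))) ` D r (\<epsilon> r)))"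
  have \<phi>_cases: "\<exists>r<d. \<exists>p<m. i = \<phi> (r, p)" if "i < n" for i
    using bij that unfolding bij_betw_def by (metis (no_types, lifting) SigmaE imageE lessThan_iff)
  have "F \<subseteq> B"
  proof
    fix e assume "e \<in> F"
    then have e: "edge_sign N e \<noteq> (\<Prod>v\<in>e. s v)" and "e \<in> edges (gen_petersen n k)"
      by (simp_all add: F_def frustrated_edges_def)
    then consider i where "i < n" "e = out i" | i where "i < n" "e = inn i"
      | i where "i < n" "e = spoke i"
      unfolding gen_petersen_def out_def inn_def spoke_def by auto
    then show "e \<in> B"
    proof cases
      case 1
      have "i = n - 1"
      proof (rule ccontr)
        assume "i \<noteq> n - 1"
        with \<open>i < n\<close> have "(i + 1) mod n = Suc i" by simp
        then have "(\<Prod>v\<in>e. s v) = a i * a (Suc i)"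
          using 1 ne(1)[of i] by (simp add: out_def sU)
        also have "\<dots> = edge_sign N e"
          using a[of i] 1 by (auto simp: a_def)
        finally show False using e by simp
      qed
      with 1 show ?thesis by (simp add: B_def)
    next
      case 2
      obtain r p where rp: "r < d" "p < m" "i = \<phi> (r, p)"
        using \<phi>_cases[OF \<open>i < n\<close>] by blast
      have "p = m - 1"
      proof (rule ccontr)
        assume "p \<noteq> m - 1"
        with rp have "Suc p < m" by simp
        have "(\<Prod>v\<in>e. s v) = s (V (\<phi> (r, p))) * s (V (\<phi> (r, Suc p)))"
          using 2 ne(2)[of i] rp by (simp add: inn_def \<phi>_Suc)
        \<comment> \<open>Both ends lie on the same inner cycle, so the factor
          \<open>\<epsilon> r\<close> squares to 1.\<close>
        also have "\<dots> = (\<epsilon> r * b r p) * (\<epsilon> r * b r (Suc p))"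
          using sV rp \<open>Suc p < m\<close> by simp
        also have "\<dots> = edge_sign N e"
          using b[of r p] \<epsilon>(1)[of r] 2 rp by (auto simp: b_def)
        finally show False using e by simp
      qed
      with 2 rp show ?thesis by (auto simp: B_def)
    next
      case 3
      obtain r p where rp: "r < d" "p < m" "i = \<phi> (r, p)"
        using \<phi>_cases[OF \<open>i < n\<close>] by blast
      have "(\<Prod>v\<in>e. s v) = a i * (\<epsilon> r * b r p)"
        using 3 rp sV by (simp add: spoke_def sU)
      \<comment> \<open>Multiplying by \<open>a i\<close>, whose square is 1, gives the form used in
        \<open>D\<close>.\<close>
      with e have "a i * edge_sign N e \<noteq> \<epsilon> r * b r p"
        using a[of i] by auto
      then have "p \<in> D r (\<epsilon> r)" using 3 rp by (simp add: D_def)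
      with 3 rp show ?thesis by (auto simp: B_def)
    qed
  qed
  have "finite (D r x)" for r x by (simp add: D_def)
  then have "finite B" by (simp add: B_def)
  have "card ((\<lambda>p. spoke (\<phi> (r, p))) ` D r (\<epsilon> r)) \<le> m div 2" for r
    using card_image_le[OF \<open>finite (D r (\<epsilon> r))\<close>, of "\<lambda>p. spoke (\<phi> (r, p))"] \<epsilon>(2)[of r]
    by linarith
  then have spokes: "card (\<Union>r<d. (\<lambda>p. spoke (\<phi> (r, p))) ` D r (\<epsilon> r)) \<le> d * (m div 2)"
    using card_UN_le[of "{..<d}" "\<lambda>r. (\<lambda>p. spoke (\<phi> (r, p))) ` D r (\<epsilon> r)"]
      sum_bounded_above[of "{..<d}" "\<lambda>r. card ((\<lambda>p. spoke (\<phi> (r, p))) ` D r (\<epsilon> r))" "m div 2"]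
    by fastforce
  have inner: "card ((\<lambda>r. inn (\<phi> (r, m - 1))) ` {..<d}) \<le> d"
    using card_image_le[of "{..<d}" "\<lambda>r. inn (\<phi> (r, m - 1))"] by simp
  have "frustration_index (gen_petersen n k) N \<le> card F"
    unfolding F_def
    by (rule frustration_index_le_card_frustrated_edges[OF finite_edges_gen_petersen s])
  also have "\<dots> \<le> card B"
    by (rule card_mono[OF \<open>finite B\<close> \<open>F \<subseteq> B\<close>])
  also have "\<dots> \<le> Suc (card ((\<lambda>r. inn (\<phi> (r, m - 1))) ` {..<d}
      \<union> (\<Union>r<d. (\<lambda>p. spoke (\<phi> (r, p))) ` D r (\<epsilon> r))))"
    unfolding B_def by (rule card_insert_le_m1) simp_all
  also have "\<dots> \<le> Suc (d + d * (m div 2))"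
    using card_Un_le[of "(\<lambda>r. inn (\<phi> (r, m - 1))) ` {..<d}"
        "\<Union>r<d. (\<lambda>p. spoke (\<phi> (r, p))) ` D r (\<epsilon> r)"] spokes inner
    by linarith
  \<comment> \<open>Successive divisions by \<open>d\<close> and by 2 amount to one division by
    \<open>2 * d\<close>.\<close>
  also have "\<dots> = d * (n div (2 * d)) + d + 1"
    by (simp add: m_def div_mult2_eq[symmetric] mult.commute)
  finally show ?thesis .
qed

theorem theorem4p1:
  fixes n k d :: nat
  assumes "0 < n" and "0 < k"
    and "2 \<le> 2 * k" and "2 * k < n"
    and "gcd n k = d" and "2 \<le> d"
  shows "max_frustration (gen_petersen n k) \<le> d * (n div (2 * d)) + d + 1"
  using finite_edges_gen_petersen frustration_index_gen_petersen_le[OF assms(3-5)]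
  by (rule max_frustration_leI)

end
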